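(* The collection $\{\chi_N(\mathbf x)\mid N\in\mathbb N\}$ of rational functions $$\chi_N(x_1,\dots,x_N)=\frac{1}{x_1(x_2-x_1)\cdots(x_N-x_{N-1})(1-x_N)}\in\mathbb Q(\mathbf x)$$ defines a character $\boldsymbol\chi$ of the permutation Hopf algebra $\mathfrak S\mathsf{Sym}$ with values in the field $\mathbb Q(\mathbf x)$, defined by the assignment $$\boldsymbol\chi:\ \mathscr F_\sigma\longmapsto\chi_m\left(x_{\sigma(1)},\dots,x_{\sigma(m)}\right),\qquad\sigma\in\mathfrak S_m,$$ where $\{\mathscr F_\sigma\mid\sigma\in\mathfrak S_m,\ m\ge0\}$ is the $\mathscr F$-basis of $\mathfrak S\mathsf{Sym}$.
   Context: $\mathbf x=\{x_1,x_2,\dots\}$ is a countably infinite set of variables and $\mathbb Q(\mathbf x)$ is the field of fractions of $\mathbb Z[\mathbf x]$; $\chi_0=1$. $\mathfrak S\mathsf{Sym}$ is the permutation (Malvenuto-Reutenauer) Hopf algebra, with fundamental basis $\mathscr F_\sigma$ indexed by all permutations $\sigma\in\mathfrak S_m$, $m\ge0$. Its product is $\mathscr F_\sigma\cdot\mathscr F_\rho=\sum_{\tau\in \mathrm{Sh}(m,n)}\mathscr F_{(\sigma\times\rho)\circ\tau^{-1}}$ for $\sigma\in\mathfrak S_m$, $\rho\in\mathfrak S_n$, where $\sigma\times\rho\in\mathfrak S_{m+n}$ acts as $\sigma$ on $\{1,\dots,m\}$ and as $m+i\mapsto m+\rho(i)$ on the rest, and $\mathrm{Sh}(m,n)$ is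 the set of permutations $\tau$ of $\{1,\dots,m+n\}$ increasing on $\{1,\dots,m\}$ and on $\{m+1,\dots,m+n\}$. A character with values in a commutative algebra is a unital algebra homomorphism.
   Formalization: Literally false: χ(F_1·F_1) = 1/(x_1x_2(1-x_1)(1-x_2)), not χ(F_1)^2. "Character" is read as unital, linear over Q, with χ(a·b) = χ(a)·shift_m(χ(b)) for a homogeneous of degree m, where shift_m sends x_i to x_{m+i}. *)

theory Defs
  imports
    Complex_Main
    "HOL-Library.Poly_Mapping"
    "HOL-Computational_Algebra.Fraction_Field"
    "HOL-Combinatorics.Permutations"
begin

section \<open>The field of rational functions in countably many variables\<close>

text \<open>A monomial is a finitely supported exponent function.  The exponent of
  $x_i$ ($i \ge 1$) is stored at position $i - 1$, so that the index type \<open>nat\<close>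
  enumerates exactly $x_1, x_2, \dots$.\<close>

type_synonym zpoly = "(nat \<Rightarrow>\<^sub>0 nat) \<Rightarrow>\<^sub>0 int"

type_synonym ratfun = "zpoly fract"

definition px :: "nat \<Rightarrow> zpoly" where
  "px i = Poly_Mapping.single (Poly_Mapping.single (i - 1) 1) 1"

definition xvar :: "nat \<Rightarrow> ratfun" where
  "xvar i = Fract (px i) 1"

lemma of_nat_fract: "of_nat n = Fract (of_nat n) (1 :: 'a :: idom)"
  by (induction n) (simp_all add: Zero_fract_def One_fract_def)

instance fract :: ("{idom, ring_char_0}") field_char_0
proof
  show "inj (of_nat :: nat \<Rightarrow> 'a fract)"
    by (rule injI) (simp add: of_nat_fract eq_fract)
qed


subsection \<open>Shifting the variables\<close>

definition mono_shift :: "nat \<Rightarrow> (nat \<Rightarrow>\<^sub>0 nat) \<Rightarrow> (nat \<Rightarrow>\<^sub>0 nat)" where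
  "mono_shift m e = (\<Sum>j\<in>Poly_Mapping.keys e. Poly_Mapping.single (j + m) (Poly_Mapping.lookup e j))"

definition zpoly_shift :: "nat \<Rightarrow> zpoly \<Rightarrow> zpoly" where
  "zpoly_shift m p = (\<Sum>e\<in>Poly_Mapping.keys p. Poly_Mapping.single (mono_shift m e) (Poly_Mapping.lookup p e))"

lemma lookup_mono_shift: "Poly_Mapping.lookup (mono_shift m e) (j + m) = Poly_Mapping.lookup e j"
proof -
  have "Poly_Mapping.lookup (mono_shift m e) (j + m) = (\<Sum>k\<in>Poly_Mapping.keys e. if k = j then Poly_Mapping.lookup e k else 0)"
    unfolding mono_shift_def lookup_sum
    by (intro sum.cong) (auto simp: lookup_single when_def)
  then show ?thesis
    by (auto simp: sum.delta in_keys_iff)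
qed

lemma lookup_mono_shift_less: "j < m \<Longrightarrow> Poly_Mapping.lookup (mono_shift m e) j = 0"
  unfolding mono_shift_def lookup_sum
  by (intro sum.neutral) (auto simp: lookup_single when_def)

lemma inj_mono_shift: "inj (mono_shift m)"
  by (rule injI, rule poly_mapping_eqI) (metis lookup_mono_shift)

lemma mono_shift_add: "mono_shift m (d + e) = mono_shift m d + mono_shift m e"
proof (rule poly_mapping_eqI)
  fix k
  show "Poly_Mapping.lookup (mono_shift m (d + e)) k = Poly_Mapping.lookup (mono_shift m d + mono_shift m e) k"
  proof (cases "k < m")
    case True
    then show ?thesis by (simp add: lookup_add lookup_mono_shift_less)
  next
    case False
    then obtain j where "k = j + m" by (metis add.commute le_Suc_ex not_less)
    then show ?thesis by (simp add: lookup_add lookup_mono_shift)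
  qed
qed

lemma lookup_zpoly_shift: "Poly_Mapping.lookup (zpoly_shift m p) (mono_shift m e) = Poly_Mapping.lookup p e"
proof -
  have "Poly_Mapping.lookup (zpoly_shift m p) (mono_shift m e) = (\<Sum>k\<in>Poly_Mapping.keys p. if k = e then Poly_Mapping.lookup p k else 0)"
    unfolding zpoly_shift_def lookup_sum
    by (intro sum.cong) (auto simp: lookup_single when_def inj_eq[OF inj_mono_shift])
  then show ?thesis
    by (auto simp: sum.delta in_keys_iff)
qed

lemma zpoly_shift_eq_iff: "zpoly_shift m p = zpoly_shift m q \<longleftrightarrow> p = q"
  by (metis lookup_zpoly_shift poly_mapping_eqI)

lemma zpoly_shift_superset:
  "finite S \<Longrightarrow> Poly_Mapping.keys p \<subseteq> S \<Longrightarrow>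
    zpoly_shift m p = (\<Sum>e\<in>S. Poly_Mapping.single (mono_shift m e) (Poly_Mapping.lookup p e))"
  unfolding zpoly_shift_def by (rule sum.mono_neutral_left) (auto simp: in_keys_iff)

lemma zpoly_shift_0 [simp]: "zpoly_shift m 0 = 0"
  by (simp add: zpoly_shift_def)

lemma zpoly_shift_single [simp]:
  "zpoly_shift m (Poly_Mapping.single e c) = Poly_Mapping.single (mono_shift m e) c"
  by (subst zpoly_shift_superset[of "{e}"]) auto

lemma zpoly_shift_add: "zpoly_shift m (p + q) = zpoly_shift m p + zpoly_shift m q"
proof -
  let ?S = "Poly_Mapping.keys p \<union> Poly_Mapping.keys q"
  have "zpoly_shift m (p + q)
      = (\<Sum>e\<in>?S. Poly_Mapping.single (mono_shift m e) (Poly_Mapping.lookup (p + q) e))"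
    by (rule zpoly_shift_superset) (auto dest: subsetD[OF Poly_Mapping.keys_add])
  also have "\<dots> = (\<Sum>e\<in>?S. Poly_Mapping.single (mono_shift m e) (Poly_Mapping.lookup p e))
                + (\<Sum>e\<in>?S. Poly_Mapping.single (mono_shift m e) (Poly_Mapping.lookup q e))"
    by (simp add: lookup_add single_add sum.distrib)
  also have "\<dots> = zpoly_shift m p + zpoly_shift m q"
    by (simp add: zpoly_shift_superset[of ?S])
  finally show ?thesis .
qed

lemma zpoly_shift_sum: "zpoly_shift m (\<Sum>i\<in>I. f i) = (\<Sum>i\<in>I. zpoly_shift m (f i))"
  by (induction I rule: infinite_finite_induct) (simp_all add: zpoly_shift_add)

lemma zpoly_expand: "(p :: zpoly) = (\<Sum>e\<in>Poly_Mapping.keys p. Poly_Mapping.single e (Poly_Mapping.lookup p e))"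
proof (rule poly_mapping_eqI)
  fix k
  have "(\<Sum>e\<in>Poly_Mapping.keys p. Poly_Mapping.lookup (Poly_Mapping.single e (Poly_Mapping.lookup p e)) k)
      = (\<Sum>e\<in>Poly_Mapping.keys p. if e = k then Poly_Mapping.lookup p e else 0)"
    by (intro sum.cong) (auto simp: lookup_single when_def)
  then show "Poly_Mapping.lookup p k = Poly_Mapping.lookup (\<Sum>e\<in>Poly_Mapping.keys p. Poly_Mapping.single e (Poly_Mapping.lookup p e)) k"
    by (simp add: lookup_sum in_keys_iff)
qed

lemma zpoly_shift_mult: "zpoly_shift m (p * q) = zpoly_shift m p * zpoly_shift m q"
proof -
  have "p * q = (\<Sum>d\<in>Poly_Mapping.keys p. Poly_Mapping.single d (Poly_Mapping.lookup p d))
      * (\<Sum>e\<in>Poly_Mapping.keys q. Poly_Mapping.single e (Poly_Mapping.lookup q e))"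
    by (simp only: zpoly_expand[symmetric])
  then have "zpoly_shift m (p * q) = (\<Sum>d\<in>Poly_Mapping.keys p. \<Sum>e\<in>Poly_Mapping.keys q.
      Poly_Mapping.single (mono_shift m d) (Poly_Mapping.lookup p d)
      * Poly_Mapping.single (mono_shift m e) (Poly_Mapping.lookup q e))"
    by (simp add: sum_product zpoly_shift_sum mult_single mono_shift_add)
  then show ?thesis
    by (simp add: zpoly_shift_def sum_product)
qed

lemma zpoly_shift_1: "zpoly_shift m 1 = 1"
  by (simp add: mono_shift_def flip: single_one)

lemma zpoly_shift_eq_0_iff [simp]: "zpoly_shift m p = 0 \<longleftrightarrow> p = 0"
  using zpoly_shift_eq_iff[of m p 0] by simp

text \<open>\<open>shift m\<close> is the endomorphism of the field of rational functions that sends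
  each $x_i$ to $x_{m+i}$.\<close>

lift_definition shift :: "nat \<Rightarrow> ratfun \<Rightarrow> ratfun"
  is "\<lambda>m r. (zpoly_shift m (fst r), zpoly_shift m (snd r))"
  by (simp add: zpoly_shift_eq_iff flip: zpoly_shift_mult)

lemma shift_Fract: "shift m (Fract p q) = Fract (zpoly_shift m p) (zpoly_shift m q)"
  by transfer (simp add: zpoly_shift_1)

lemma shift_add: "shift m (r + s) = shift m r + shift m s"
  by (cases r, cases s) (simp add: shift_Fract zpoly_shift_add zpoly_shift_mult)

lemma shift_mult: "shift m (r * s) = shift m r * shift m s"
  by (cases r, cases s) (simp add: shift_Fract zpoly_shift_mult)

lemma shift_1: "shift m 1 = 1"
  by (simp add: One_fract_def shift_Fract zpoly_shift_1)

lemma shift_xvar: "1 \<le> i \<Longrightarrow> shift m (xvar i) = xvar (m + i)"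
  by (simp add: xvar_def px_def shift_Fract zpoly_shift_1 mono_shift_def add.commute)


section \<open>The permutation Hopf algebra as an algebra\<close>

text \<open>All permutations of all sets $\{1,\dots,m\}$, $m \ge 0$, tagged by $m$.\<close>

typedef gperm = "{(m :: nat, s :: nat \<Rightarrow> nat). s permutes {1..m}}"
  by (rule exI[of _ "(0, id)"]) (simp add: permutes_id)

definition gdeg :: "gperm \<Rightarrow> nat" where "gdeg s = fst (Rep_gperm s)"

definition gfun :: "gperm \<Rightarrow> nat \<Rightarrow> nat" where "gfun s = snd (Rep_gperm s)"

text \<open>Only meaningful if \<open>s permutes {1..m}\<close>.\<close>

definition gperm_of :: "nat \<Rightarrow> (nat \<Rightarrow> nat) \<Rightarrow> gperm" where
  "gperm_of m s = Abs_gperm (m, s)"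

lemma gfun_permutes: "gfun s permutes {1..gdeg s}"
  using Rep_gperm[of s] by (auto simp: gdeg_def gfun_def)

lemma gdeg_gperm_of: "s permutes {1..m} \<Longrightarrow> gdeg (gperm_of m s) = m"
  by (simp add: gdeg_def gperm_of_def Abs_gperm_inverse)

lemma gfun_gperm_of: "s permutes {1..m} \<Longrightarrow> gfun (gperm_of m s) = s"
  by (simp add: gfun_def gperm_of_def Abs_gperm_inverse)

definition cross :: "nat \<Rightarrow> (nat \<Rightarrow> nat) \<Rightarrow> (nat \<Rightarrow> nat) \<Rightarrow> nat \<Rightarrow> nat" where
  "cross m s r i = (if i \<le> m then s i else m + r (i - m))"

definition Sh :: "nat \<Rightarrow> nat \<Rightarrow> (nat \<Rightarrow> nat) set" where
  "Sh m n = {t. t permutes {1..m + n} \<and> strict_mono_on {1..m} t \<and> strict_mono_on {m + 1..m + n} t}"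

text \<open>The underlying space is the rational vector space with basis \<open>gperm\<close>.
  (The multiplication that \<open>Poly_Mapping\<close> provides is a different one and is not used.)\<close>

type_synonym ssym = "gperm \<Rightarrow>\<^sub>0 rat"

definition ssym_scale :: "rat \<Rightarrow> ssym \<Rightarrow> ssym" where
  "ssym_scale c a = Poly_Mapping.map ((*) c) a"

definition basis_F :: "gperm \<Rightarrow> ssym" where
  "basis_F s = Poly_Mapping.single s 1"

definition F_mult :: "gperm \<Rightarrow> gperm \<Rightarrow> ssym" where
  "F_mult s r = (\<Sum>t\<in>Sh (gdeg s) (gdeg r).
     basis_F (gperm_of (gdeg s + gdeg r) (cross (gdeg s) (gfun s) (gfun r) \<circ> inv t)))"

definition ssym_mult :: "ssym \<Rightarrow> ssym \<Rightarrow> ssym" (infixl "\<star>" 70) where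
  "a \<star> b = (\<Sum>s\<in>Poly_Mapping.keys a. \<Sum>r\<in>Poly_Mapping.keys b. ssym_scale (Poly_Mapping.lookup a s * Poly_Mapping.lookup b r) (F_mult s r))"

definition ssym_one :: ssym where
  "ssym_one = basis_F (gperm_of 0 id)"

definition ssym_homogeneous :: "nat \<Rightarrow> ssym set" where
  "ssym_homogeneous m = {a. \<forall>s\<in>Poly_Mapping.keys a. gdeg s = m}"

definition ratfun_scale :: "rat \<Rightarrow> ratfun \<Rightarrow> ratfun" where
  "ratfun_scale c r = of_rat c * r"

lemma lookup_ssym_scale: "Poly_Mapping.lookup (ssym_scale c a) s = c * Poly_Mapping.lookup a s"
  by (simp add: ssym_scale_def map.rep_eq when_def)

lemma vector_space_ssym: "vector_space ssym_scale"
  by unfold_locales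
     (auto intro!: poly_mapping_eqI simp: lookup_ssym_scale lookup_add algebra_simps)

lemma vector_space_ratfun: "vector_space ratfun_scale"
  by unfold_locales (auto simp: ratfun_scale_def of_rat_add of_rat_mult algebra_simps)

lemma basis_F_mult: "basis_F s \<star> basis_F r = F_mult s r"
  by (auto simp: ssym_mult_def basis_F_def intro!: poly_mapping_eqI simp: lookup_ssym_scale)


section \<open>Characters\<close>

definition chi :: "nat \<Rightarrow> (nat \<Rightarrow> 'a) \<Rightarrow> 'a :: field" where
  "chi N v = (if N = 0 then 1
     else 1 / (v 1 * (\<Prod>i = 2..N. v i - v (i - 1)) * (1 - v N)))"

text \<open>A unital, linear and multiplicative map, where multiplicativity is understood as for
  moulds: in the product of the values at two elements the second value is written in
  fresh variables.  If \<open>a\<close> has degree \<open>m\<close>, its value involves $x_1,\dots,x_m$, so the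
  value at \<open>b\<close> is written in $x_{m+1}, x_{m+2}, \dots$, exactly as the right factor of
  \<open>cross\<close> is moved to $m+1, m+2, \dots$.  By linearity, homogeneous left factors suffice.
  Without the shift the values of \<open>chi\<close> do not define a multiplicative map at all;
  see \<open>no_unshifted_character\<close>.\<close>

definition is_character :: "(ssym \<Rightarrow> ratfun) \<Rightarrow> bool" where
  "is_character f \<longleftrightarrow>
     Vector_Spaces.linear ssym_scale ratfun_scale f \<and>
     f ssym_one = 1 \<and>
     (\<forall>m. \<forall>a \<in> ssym_homogeneous m. \<forall>b. f (a \<star> b) = f a * shift m (f b))"

lemma Sh_1_1: "Sh 1 1 = {id, Transposition.transpose 1 2}"
proof -
  have "{1..1 + 1} = {1, 2 :: nat}" by auto
  moreover have "t permutes {1, 2 :: nat} \<longleftrightarrow> t = id \<or> t = Transposition.transpose 1 2" for t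
  proof
    assume t: "t permutes {1, 2 :: nat}"
    show "t = id \<or> t = Transposition.transpose 1 2"
    proof (cases "t 1 = 1")
      case True
      then have "t 2 = 2" using t permutes_in_image[OF t, of 2] permutes_inj[OF t]
        by (metis insertCI insertE inj_eq singletonD)
      then have "t = id" using True t by (intro ext) (metis id_apply insertE permutes_not_in singletonD)
      then show ?thesis ..
    next
      case False
      then have 1: "t 1 = 2" using permutes_in_image[OF t, of 1] by auto
      then have 2: "t 2 = 1" using permutes_in_image[OF t, of 2] permutes_inj[OF t]
        by (metis insertCI insertE inj_eq singletonD False)
      have "t = Transposition.transpose 1 2"
        using 1 2 t by (intro ext) (auto simp: Transposition.transpose_def dest: permutes_not_in)
      then show ?thesis ..
    qed
  qed (auto intro: permutes_swap_id permutes_id)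
  ultimately show ?thesis
    unfolding Sh_def by (simp only:) (auto simp: strict_mono_on_def)
qed

lemma px_facts:
  "px 1 \<noteq> 0" "px 2 \<noteq> 0" "px 1 \<noteq> 1" "px 2 \<noteq> 1" "px 1 \<noteq> px 2" "px 1 + px 2 \<noteq> 1"
proof -
  let ?e = "Poly_Mapping.single 0 1 :: nat \<Rightarrow>\<^sub>0 nat"
  let ?d = "Poly_Mapping.single 1 1 :: nat \<Rightarrow>\<^sub>0 nat"
  have ed: "?e \<noteq> ?d"
    by (metis lookup_single_eq lookup_single_not_eq zero_neq_one)
  have e0: "?e \<noteq> 0" and d0: "?d \<noteq> 0"
    by (metis lookup_single_eq lookup_zero zero_neq_one)+
  have p1: "px 1 = Poly_Mapping.single ?e 1" and p2: "px 2 = Poly_Mapping.single ?d 1"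
    by (simp_all add: px_def)
  have l: "Poly_Mapping.lookup (px 1) ?e = 1" "Poly_Mapping.lookup (px 1) ?d = 0"
     "Poly_Mapping.lookup (px 2) ?d = 1" "Poly_Mapping.lookup (px 2) ?e = 0"
     "Poly_Mapping.lookup (1 :: zpoly) ?e = 0" "Poly_Mapping.lookup (1 :: zpoly) ?d = 0"
    using ed e0 d0 unfolding p1 p2 by (auto simp: lookup_single lookup_one when_def)
  show "px 1 \<noteq> 0" "px 2 \<noteq> 0" "px 1 \<noteq> 1" "px 2 \<noteq> 1" "px 1 \<noteq> px 2" "px 1 + px 2 \<noteq> 1"
    using l by (metis lookup_zero zero_neq_one lookup_add add_0_right)+
qed

text \<open>The product of $F_1$ with itself is $F_{12} + F_{21}$, whose value is
  $1/(x_1 x_2 (1-x_1)(1-x_2))$ and not the square of $1/(x_1(1-x_1))$.\<close>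

lemma no_unshifted_character:
  "\<nexists>f. Vector_Spaces.linear ssym_scale ratfun_scale f \<and>
       (\<forall>a b. f (a \<star> b) = f a * f b) \<and>
       (\<forall>s. f (basis_F s) = chi (gdeg s) (\<lambda>i. xvar (gfun s i)))"
proof
  let ?w = "Transposition.transpose 1 (2 :: nat)"
  assume "\<exists>f. Vector_Spaces.linear ssym_scale ratfun_scale f \<and>
       (\<forall>a b. f (a \<star> b) = f a * f b) \<and>
       (\<forall>s. f (basis_F s) = chi (gdeg s) (\<lambda>i. xvar (gfun s i)))"
  then obtain f where lin: "Vector_Spaces.linear ssym_scale ratfun_scale f"
    and mult: "\<And>a b. f (a \<star> b) = f a * f b"
    and val: "\<And>s. f (basis_F s) = chi (gdeg s) (\<lambda>i. xvar (gfun s i))"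
    by blast
  interpret Vector_Spaces.linear ssym_scale ratfun_scale f by (fact lin)
  define s where "s = gperm_of 1 id"
  have s: "gdeg s = 1" "gfun s = id"
    by (simp_all add: s_def gdeg_gperm_of gfun_gperm_of permutes_id)
  have w: "?w permutes {1..2}" by (rule permutes_swap_id) auto
  have cr: "cross 1 id id = id"
    by (auto simp: cross_def fun_eq_iff)
  have ne: "id \<noteq> ?w"
    by (metis id_apply transpose_apply_first numeral_eq_one_iff semiring_norm(85))
  have "F_mult s s = (\<Sum>t\<in>{id, ?w}. basis_F (gperm_of 2 (inv t)))"
    unfolding F_mult_def s Sh_1_1 cr one_add_one by simp
  also have "\<dots> = basis_F (gperm_of 2 id) + basis_F (gperm_of 2 ?w)"
    using ne by simp
  finally have "f (basis_F s) * f (basis_F s)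
      = f (basis_F (gperm_of 2 id)) + f (basis_F (gperm_of 2 ?w))"
    by (metis mult basis_F_mult add)
  moreover define a b where "a = xvar 1" and "b = xvar 2"
  ultimately have eq: "1 / (a * (1 - a)) * (1 / (a * (1 - a)))
      = 1 / (a * (b - a) * (1 - b)) + 1 / (b * (a - b) * (1 - a))"
    by (simp add: val s gdeg_gperm_of gfun_gperm_of permutes_id chi_def
        gdeg_gperm_of[OF w, simplified] gfun_gperm_of[OF w, simplified])
  have nz: "a \<noteq> 0" "b \<noteq> 0" "1 - a \<noteq> 0" "1 - b \<noteq> 0" "b - a \<noteq> 0" "a - b \<noteq> 0" "1 - (a + b) \<noteq> 0"
    using px_facts by (auto simp: a_def b_def xvar_def Zero_fract_def One_fract_def eq_fract)
  have "1 / (a * (b - a) * (1 - b)) + 1 / (b * (a - b) * (1 - a)) = 1 / (a * b * (1 - a) * (1 - b))"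
    using nz by (simp add: divide_simps) algebra
  with eq have "1 / (a * (1 - a) * (a * (1 - a))) = 1 / (a * b * (1 - a) * (1 - b))"
    by simp
  then have "a * b * (1 - a) * (1 - b) = a * (1 - a) * (a * (1 - a))"
    using nz by (simp add: divide_simps)
  then have "(a * (1 - a)) * ((b - a) * (1 - (a + b))) = 0"
    by algebra
  then show False using nz by simp
qed

end

theory Submission
  imports Defs
begin

text \<open>Linearity and the values on the basis $F_\sigma$ determine $\chi$, so the point is that the
  linear extension is multiplicative, and this is needed on pairs of basis elements only.
  For $\sigma$ of degree $m$ and $\rho$ of degree $n$ put $y_i = x_{(\sigma\times\rho)(i)}$.
  As $\tau$ runs through the shuffle permutations, the words
  $y_{\tau^{-1}(1)} \cdots y_{\tau^{-1}(m+n)}$ run once through all shuffles of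
  $y_1 \cdots y_m$ and $y_{m+1} \cdots y_{m+n}$: the letter $y_i$ stands at position $\tau(i)$, so
  $\tau$ being increasing on the two blocks says that each of the two words keeps its order
  (\<open>bij_betw_Sh_shuffles\<close>).  Hence the claim is that the product of
  $\chi_m$ and $\chi_n$, taken at disjoint sets of variables, is the sum of $\chi_{m+n}$ over all
  shuffles of the two words of arguments (\<open>sum_Sh_chi\<close>).

  For this identity, regard $0, y_1, \dots, y_N, 1$ as a chain of points and $\chi_N$ as the
  product of the reciprocals of its successive differences.  If the end points $0$ and $1$ are
  replaced by arbitrary $a$ and $b$, the identity becomes
  $$\sum_{w} c(a, w, b) = (b - a)\, c(a, u, b)\, c(a, v, b),$$
  where $w$ runs over the shuffles of $u$ and $v$ (\<open>gap_recip_shuffles\<close>).  In this form it can be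
  proved by induction: a shuffle of $u = x u'$ and $v = y v'$ starts with $x$ or with $y$, and
  removing this letter leaves a sum of the same kind with $a$ replaced by $x$ or $y$.  Only
  an identity between four points, the partial fraction expansion in $a$, remains.

  The value at $\rho$, written in the variables $x_{m+1}, x_{m+2}, \dots$, is
  $\chi_n(y_{m+1}, \dots, y_{m+n})$ because \<open>shift\<close> is a field endomorphism.\<close>

section \<open>The shuffle identity\<close>

text \<open>The product of the reciprocal gaps of the chain that starts at $a$, visits the letters of
  the word, and ends at $b$.  Both end points are arguments because the induction over
  shuffles moves the starting point.\<close>

fun gap_recip :: "'a :: field \<Rightarrow> 'a list \<Rightarrow> 'a \<Rightarrow> 'a" where
  "gap_recip a [] b = 1 / (b - a)"
| "gap_recip a (x # xs) b = gap_recip x xs b / (x - a)"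

text \<open>The shuffles of two nonempty words split by their first letter, which becomes the new
  starting point of the chain.  The words consist of indices that $v$ evaluates, which allows the
  sum to be reindexed by shuffle permutations.
  The factor $b - a$ is the inverse of the value at the empty word, which makes the
  identity correct when one of the words is empty.\<close>

lemma gap_recip_shuffles:
  assumes "distinct (a # map v (xs @ ys) @ [b])"
  shows "(\<Sum>w\<in>shuffles xs ys. gap_recip a (map v w) b)
    = (b - a) * gap_recip a (map v xs) b * gap_recip a (map v ys) b"
  using assms
proof (induction xs ys arbitrary: a rule: shuffles.induct)
  case (1 ys)
  then show ?case by auto
next
  case (2 xs)
  then show ?case by auto
next
  case (3 x xs y ys)
  let ?P = "gap_recip (v x) (map v xs) b" and ?Q = "gap_recip (v y) (map v ys) b"
  have disj: "(#) x ` shuffles xs (y # ys) \<inter> (#) y ` shuffles (x # xs) ys = {}"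
    using 3 by auto
  have IHx: "(\<Sum>w\<in>shuffles xs (y # ys). gap_recip (v x) (map v w) b)
      = (b - v x) * ?P * (?Q / (v y - v x))"
    using "3.IH"(1)[of "v x"] "3.prems" by auto
  have IHy: "(\<Sum>w\<in>shuffles (x # xs) ys. gap_recip (v y) (map v w) b)
      = (b - v y) * (?P / (v x - v y)) * ?Q"
    using "3.IH"(2)[of "v y"] "3.prems" by auto
  have nz: "v x - a \<noteq> 0" "v y - a \<noteq> 0" "v y - v x \<noteq> 0" "v x - v y \<noteq> 0"
    using "3.prems" by auto
  \<comment> \<open>Both sums contain the product of \<open>?P\<close> and \<open>?Q\<close>; the cofactors are partial fractions in \<open>a\<close>.\<close>
  have pf: "(b - v x) / ((v y - v x) * (v x - a)) + (b - v y) / ((v x - v y) * (v y - a))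
      = (b - a) / ((v x - a) * (v y - a))"
    using nz by (simp add: divide_simps) (simp add: algebra_simps)
  have "(\<Sum>w\<in>shuffles (x # xs) (y # ys). gap_recip a (map v w) b)
      = (\<Sum>w\<in>shuffles xs (y # ys). gap_recip (v x) (map v w) b) / (v x - a)
      + (\<Sum>w\<in>shuffles (x # xs) ys. gap_recip (v y) (map v w) b) / (v y - a)"
    by (simp add: sum.union_disjoint[OF _ _ disj] sum.reindex sum_divide_distrib)
  also have "\<dots> = ?P * ?Q * ((b - v x) / ((v y - v x) * (v x - a))
      + (b - v y) / ((v x - v y) * (v y - a)))"
    unfolding IHx IHy by (simp add: distrib_left mult_ac)
  also have "\<dots> = (b - a) * gap_recip a (map v (x # xs)) b * gap_recip a (map v (y # ys)) b"
    unfolding pf by simp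
  finally show ?case .
qed

lemma gap_recip_upt:
  assumes "k \<le> N"
  shows "gap_recip (v k) (map v [Suc k..<Suc N]) b
    = 1 / ((\<Prod>i = Suc k..N. v i - v (i - 1)) * (b - v N))"
  using assms
proof (induction k rule: inc_induct)
  case base
  then show ?case by simp
next
  case (step k)
  have "[Suc k..<Suc N] = Suc k # [Suc (Suc k)..<Suc N]"
    using step.hyps by (simp add: upt_conv_Cons del: upt_Suc)
  moreover have "{Suc k..N} = insert (Suc k) {Suc (Suc k)..N}"
    using step.hyps by auto
  ultimately show ?case
    using step.IH by simp
qed

lemma chi_eq_gap_recip: "chi N v = gap_recip 0 (map v [1..<Suc N]) 1"
proof (cases "N = 0")
  case False
  then have "[1..<Suc N] = 1 # [Suc 1..<Suc N]"
    by (simp add: upt_conv_Cons del: upt_Suc)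
  then show ?thesis
    using False gap_recip_upt[of 1 N v 1] by (simp add: chi_def numeral_2_eq_2 del: upt_Suc)
qed (simp add: chi_def)

section \<open>Shuffle permutations and shuffles of words\<close>

lemma sorted_wrt_filter_iff:
  "sorted_wrt R (filter P xs) \<longleftrightarrow> sorted_wrt (\<lambda>x y. P x \<longrightarrow> P y \<longrightarrow> R x y) xs"
  by (induction xs) auto

lemma sorted_wrt_upt_iff:
  "sorted_wrt R [a..<b] \<longleftrightarrow> (\<forall>p\<in>{a..<b}. \<forall>q\<in>{a..<b}. p < q \<longrightarrow> R p q)"
  by (induction b) (auto simp: sorted_wrt_append less_Suc_eq)

text \<open>A word is a shuffle of two given words on disjoint sets of letters iff its restriction to
  each of the two sets of letters is the given word there.  Here both restrictions are the
  increasing words, so the criterion is that letters of the same block occur in increasing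
  order.\<close>

lemma in_shuffles_upt_iff:
  assumes "distinct w" "set w = {1..m + n}"
  shows "w \<in> shuffles [1..<Suc m] [Suc m..<Suc (m + n)] \<longleftrightarrow>
    sorted_wrt (\<lambda>i j. (i \<le> m \<longleftrightarrow> j \<le> m) \<longrightarrow> i < j) w"
proof -
  have upt_iff: "filter P w = [a..<b] \<longleftrightarrow> sorted_wrt (\<lambda>i j. P i \<longrightarrow> P j \<longrightarrow> i < j) w"
    if "set (filter P w) = {a..<b}" for P a b
  proof
    assume "filter P w = [a..<b]"
    then show "sorted_wrt (\<lambda>i j. P i \<longrightarrow> P j \<longrightarrow> i < j) w"
      by (metis sorted_wrt_filter_iff sorted_wrt_upt)
  next
    assume "sorted_wrt (\<lambda>i j. P i \<longrightarrow> P j \<longrightarrow> i < j) w"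
    then have "sorted_wrt (<) (filter P w)"
      by (simp only: sorted_wrt_filter_iff)
    then show "filter P w = [a..<b]"
      using that by (intro strict_sorted_equal) auto
  qed
  have "w \<in> shuffles [1..<Suc m] [Suc m..<Suc (m + n)] \<longleftrightarrow>
      partition (\<lambda>i. i \<le> m) w = ([1..<Suc m], [Suc m..<Suc (m + n)])"
    by (subst inv_image_partition[symmetric, where P = "\<lambda>i. i \<le> m"]) auto
  also have "\<dots> \<longleftrightarrow> filter (\<lambda>i. i \<le> m) w = [1..<Suc m] \<and>
      filter (\<lambda>i. \<not> i \<le> m) w = [Suc m..<Suc (m + n)]"
    by (simp add: o_def del: upt_Suc)
  also have "\<dots> \<longleftrightarrow> sorted_wrt (\<lambda>i j. i \<le> m \<longrightarrow> j \<le> m \<longrightarrow> i < j) w \<and>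
      sorted_wrt (\<lambda>i j. \<not> i \<le> m \<longrightarrow> \<not> j \<le> m \<longrightarrow> i < j) w"
    using assms by (subst (1 2) upt_iff) auto
  also have "\<dots> \<longleftrightarrow> sorted_wrt (\<lambda>i j. (i \<le> m \<longleftrightarrow> j \<le> m) \<longrightarrow> i < j) w"
    unfolding sorted_wrt_iff_nth_less by blast
  finally show ?thesis .
qed

text \<open>The letter $i$ stands at position $t(i)$ of the one-line notation of $t^{-1}$, so
  increasing order of positions within a block is monotonicity of $t$ on this block.\<close>

lemma one_line_inv_in_shuffles_iff:
  assumes t: "t permutes {1..m + n}"
  shows "map (inv t) [1..<Suc (m + n)] \<in> shuffles [1..<Suc m] [Suc m..<Suc (m + n)]
    \<longleftrightarrow> t \<in> Sh m n"
proof -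
  let ?R = "\<lambda>i j :: nat. (i \<le> m \<longleftrightarrow> j \<le> m) \<longrightarrow> i < j"
  let ?w = "map (inv t) [1..<Suc (m + n)]"
  have it: "inv t permutes {1..m + n}"
    using t by (rule permutes_inv)
  have "distinct ?w"
    using permutes_inj[OF it] by (auto simp: distinct_map intro: inj_on_subset simp del: upt_Suc)
  moreover have "set ?w = {1..m + n}"
    using permutes_image[OF it] by (simp add: atLeastLessThanSuc_atLeastAtMost del: upt_Suc)
  ultimately have "?w \<in> shuffles [1..<Suc m] [Suc m..<Suc (m + n)] \<longleftrightarrow> sorted_wrt ?R ?w"
    by (rule in_shuffles_upt_iff)
  also have "\<dots> \<longleftrightarrow> (\<forall>p\<in>{1..m + n}. \<forall>q\<in>{1..m + n}. p < q \<longrightarrow> ?R (inv t p) (inv t q))"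
    unfolding sorted_wrt_map sorted_wrt_upt_iff atLeastLessThanSuc_atLeastAtMost ..
  also have "\<dots> \<longleftrightarrow> (\<forall>i\<in>{1..m + n}. \<forall>j\<in>{1..m + n}. t i < t j \<longrightarrow> ?R i j)"
    \<comment> \<open>positions are written as \<open>p = t i\<close> and \<open>q = t j\<close>\<close>
    by (subst (1 2) permutes_image[OF t, symmetric])
      (simp add: permutes_inverses[OF t])
  also have "\<dots> \<longleftrightarrow> (\<forall>i\<in>{1..m + n}. \<forall>j\<in>{1..m + n}. (i \<le> m \<longleftrightarrow> j \<le> m) \<longrightarrow> i < j \<longrightarrow> t i < t j)"
    using permutes_inj[OF t] by (metis inj_eq linorder_neqE_nat less_asym)
  also have "\<dots> \<longleftrightarrow> t \<in> Sh m n"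
  proof -
    have "{1..m + n} = {1..m} \<union> {m + 1..m + n}" and "\<forall>i\<in>{m + 1..m + n}. \<not> i \<le> m"
      by auto
    then show ?thesis
      using t by (auto simp: Sh_def strict_mono_on_def)
  qed
  finally show ?thesis .
qed

lemma bij_betw_Sh_shuffles:
  "bij_betw (\<lambda>t. map (inv t) [1..<Suc (m + n)]) (Sh m n)
     (shuffles [1..<Suc m] [Suc m..<Suc (m + n)])"
  unfolding bij_betw_def
proof
  let ?N = "m + n"
  show "inj_on (\<lambda>t. map (inv t) [1..<Suc ?N]) (Sh m n)"
  proof (rule inj_onI)
    fix t t' assume "t \<in> Sh m n" "t' \<in> Sh m n" 
      and eq: "map (inv t) [1..<Suc ?N] = map (inv t') [1..<Suc ?N]"
    then have t: "t permutes {1..?N}" "t' permutes {1..?N}"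
      by (auto simp: Sh_def)
    have "inv t = inv t'"
      using eq t[THEN permutes_inv, THEN permutes_not_in]
      by (intro ext) (metis atLeastLessThanSuc_atLeastAtMost map_eq_conv set_upt)
    then show "t = t'"
      using t by (metis permutes_inv_inv)
  qed
next
  let ?N = "m + n"
  show "(\<lambda>t. map (inv t) [1..<Suc ?N]) ` Sh m n = shuffles [1..<Suc m] [Suc m..<Suc ?N]" (is "?L = ?R")
  proof
    show "?L \<subseteq> ?R"
    proof clarify
      fix t assume "t \<in> Sh m n"
      then show "map (inv t) [1..<Suc ?N] \<in> ?R"
        using one_line_inv_in_shuffles_iff[of t m n] by (simp add: Sh_def del: upt_Suc)
    qed
    show "?R \<subseteq> ?L"
    proof
      fix w assume w: "w \<in> ?R"
      have len: "length w = ?N"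
        using length_shuffles[OF w] by simp
      have set: "set w = {1..?N}"
        unfolding set_shuffles[OF w] set_upt by auto
      \<comment> \<open>The preimage of \<open>w\<close> is the inverse of the permutation with one-line notation \<open>w\<close>;
        lists are indexed from 0.\<close>
      define s where "s i = (if i \<in> {1..?N} then w ! (i - 1) else i)" for i
      have map_s: "map s [1..<Suc ?N] = w"
        by (rule nth_equalityI) (auto simp: s_def len simp del: upt_Suc)
      have "s permutes {1..?N}"
      proof (rule bij_imp_permutes)
        have "s ` {1..?N} = set (map s [1..<Suc ?N])"
          by (simp only: list.set_map set_upt atLeastLessThanSuc_atLeastAtMost)
        then have im: "s ` {1..?N} = {1..?N}"
          unfolding map_s set .
        then have "inj_on s {1..?N}"
          by (intro eq_card_imp_inj_on) simp_all
        then show "bij_betw s {1..?N} {1..?N}"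
          using im by (rule bij_betw_imageI)
      qed (auto simp: s_def)
      then have "inv s permutes {1..?N}" "inv (inv s) = s"
        by (auto simp: permutes_inv permutes_inv_inv)
      then show "w \<in> ?L"
        using one_line_inv_in_shuffles_iff[of "inv s" m n] w map_s by (intro image_eqI[of _ _ "inv s"]) auto
    qed
  qed
qed

text \<open>The chain identity with end points 0 and 1, whose gap $b - a$ is 1.  The arguments
  must avoid 0 and 1 for the chain to have distinct points.\<close>

lemma sum_Sh_chi:
  fixes y :: "nat \<Rightarrow> 'a :: field"
  assumes inj: "inj_on y {1..m + n}" and "0 \<notin> y ` {1..m + n}" "1 \<notin> y ` {1..m + n}"
  shows "(\<Sum>t\<in>Sh m n. chi (m + n) (\<lambda>i. y (inv t i))) = chi m y * chi n (\<lambda>i. y (m + i))"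
proof -
  let ?u = "[1..<Suc m]" and ?v = "[Suc m..<Suc (m + n)]"
  have uv: "?u @ ?v = [1..<Suc (m + n)]"
    by (metis Suc_le_mono le_add1 le_add2 plus_1_eq_Suc upt_add_eq_append add_Suc le_add_diff_inverse)
  have "distinct (map y (?u @ ?v))"
    using inj unfolding uv by (simp add: distinct_map atLeastLessThanSuc_atLeastAtMost del: upt_Suc)
  moreover have "set (map y (?u @ ?v)) = y ` {1..m + n}"
    unfolding uv by (simp add: atLeastLessThanSuc_atLeastAtMost del: upt_Suc)
  ultimately have dist: "distinct (0 # map y (?u @ ?v) @ [1])"
    using assms(2,3) by (auto simp del: upt_Suc)
  have "(\<Sum>t\<in>Sh m n. chi (m + n) (\<lambda>i. y (inv t i)))
      = (\<Sum>t\<in>Sh m n. gap_recip 0 (map y (map (inv t) [1..<Suc (m + n)])) 1)"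
    by (simp add: chi_eq_gap_recip o_def del: upt_Suc)
  also have "\<dots> = (\<Sum>w\<in>shuffles ?u ?v. gap_recip 0 (map y w) 1)"
    by (rule sum.reindex_bij_betw[OF bij_betw_Sh_shuffles, where g = "\<lambda>w. gap_recip 0 (map y w) 1"])
  also have "\<dots> = gap_recip 0 (map y ?u) 1 * gap_recip 0 (map y ?v) 1"
    using gap_recip_shuffles[OF dist] by simp
  also have "map y ?v = map (\<lambda>i. y (m + i)) [1..<Suc n]"
    by (rule nth_equalityI) (auto simp del: upt_Suc)
  finally show ?thesis
    by (simp only: chi_eq_gap_recip)
qed

section \<open>Values at the fundamental basis\<close>

lemma single_1_eq_iff:
  "Poly_Mapping.single a (1 :: 'b :: zero_neq_one) = Poly_Mapping.single b 1 \<longleftrightarrow> a = b"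
  by (metis lookup_single_eq lookup_single_not_eq zero_neq_one)

lemma single_1_neq_0: "Poly_Mapping.single a (1 :: 'b :: zero_neq_one) \<noteq> 0"
  by (metis lookup_single_eq lookup_zero zero_neq_one)

lemma px_eq_iff: "px i = px j \<longleftrightarrow> i - 1 = j - 1"
  unfolding px_def single_1_eq_iff ..

lemma px_neq_0_1: "px i \<noteq> 0" "px i \<noteq> 1"
proof -
  show "px i \<noteq> 0"
    unfolding px_def by (rule single_1_neq_0)
  have "px i \<noteq> Poly_Mapping.single 0 1"
    unfolding px_def single_1_eq_iff by (rule single_1_neq_0)
  then show "px i \<noteq> 1"
    by simp
qed

lemma xvar_neq_0_1: "xvar i \<noteq> 0" "xvar i \<noteq> 1"
  using px_neq_0_1 by (simp_all add: xvar_def Zero_fract_def One_fract_def eq_fract)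

lemma inj_on_xvar: "inj_on xvar {1..}"
  by (rule inj_onI) (auto simp: xvar_def eq_fract px_eq_iff)

lemma cross_permutes:
  assumes s: "s permutes {1..m}" and r: "r permutes {1..n}"
  shows "cross m s r permutes {1..m + n}"
proof (rule bij_imp_permutes)
  have low: "cross m s r i \<in> {1..m} \<and> cross m s r i = s i" if "i \<in> {1..m}" for i
    using that permutes_in_image[OF s, of i] by (auto simp: cross_def)
  have high: "cross m s r i \<in> {m + 1..m + n} \<and> cross m s r i = m + r (i - m)" if "i \<in> {m + 1..m + n}" for i
    using that permutes_in_image[OF r, of "i - m"] by (auto simp: cross_def)
  have split: "{1..m + n} = {1..m} \<union> {m + 1..m + n}" by auto
  have "inj_on (cross m s r) {1..m + n}"
  proof (rule inj_onI)
    fix i j assume ij: "i \<in> {1..m + n}" "j \<in> {1..m + n}" and eq: "cross m s r i = cross m s r j"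
    consider "i \<in> {1..m}" "j \<in> {1..m}" | "i \<in> {m + 1..m + n}" "j \<in> {m + 1..m + n}"
    proof -
      have "i \<in> {1..m} \<longleftrightarrow> j \<in> {1..m}"
        using low[of i] low[of j] high[of i] high[of j] ij eq unfolding split by auto
      then show thesis
        using ij that unfolding split by blast
    qed
    then show "i = j"
    proof cases
      case 1
      then have "s i = s j"
        using low[of i] low[of j] eq by metis
      then show ?thesis
        using permutes_inj[OF s] by (simp only: inj_eq)
    next
      case 2
      then have "r (i - m) = r (j - m)"
        using high[of i] high[of j] eq by (metis add_left_cancel)
      then have "i - m = j - m"
        using permutes_inj[OF r] by (simp only: inj_eq)
      then show ?thesis
        using 2 by auto
    qed
  qed
  moreover have "cross m s r ` {1..m + n} \<subseteq> {1..m + n}"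
  proof (rule image_subsetI)
    fix i assume "i \<in> {1..m + n}"
    then show "cross m s r i \<in> {1..m + n}"
      using low[of i] high[of i] unfolding split by blast
  qed
  ultimately show "bij_betw (cross m s r) {1..m + n} {1..m + n}"
    by (simp add: bij_betw_def endo_inj_surj)
next
  fix i assume i: "i \<notin> {1..m + n}"
  show "cross m s r i = i"
  proof (cases "i \<le> m")
    case True
    then have "i \<notin> {1..m}"
      using i by auto
    then show ?thesis
      using True permutes_not_in[OF s] by (simp add: cross_def)
  next
    case False
    then have "i - m \<notin> {1..n}"
      using i by auto
    then show ?thesis
      using False permutes_not_in[OF r] by (simp add: cross_def)
  qed
qed

lemma shift_0: "shift m 0 = 0"
  by (simp add: Zero_fract_def shift_Fract zpoly_shift_1)

lemma shift_minus: "shift m (- r) = - shift m r"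
  using shift_add[of m r "- r"] by (simp add: shift_0 add_eq_0_iff)

lemma shift_diff: "shift m (r - s) = shift m r - shift m s"
  using shift_add[of m r "- s"] by (simp add: shift_minus)

lemma shift_divide: "shift m (r / s) = shift m r / shift m s"
proof (cases "s = 0")
  case False
  then have "shift m (inverse s) * shift m s = 1"
    by (simp add: shift_1 flip: shift_mult)
  then have "shift m (inverse s) = inverse (shift m s)"
    by (metis inverse_unique mult.commute)
  then show ?thesis
    by (simp add: divide_inverse shift_mult)
qed (simp add: shift_0)

lemma shift_prod: "shift m (\<Prod>i\<in>A. f i) = (\<Prod>i\<in>A. shift m (f i))"
  by (induction A rule: infinite_finite_induct) (simp_all add: shift_1 shift_mult)

lemma shift_sum: "shift m (\<Sum>i\<in>A. f i) = (\<Sum>i\<in>A. shift m (f i))"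
  by (induction A rule: infinite_finite_induct) (simp_all add: shift_0 shift_add)

lemma shift_of_nat: "shift m (of_nat k) = of_nat k"
  by (induction k) (simp_all add: shift_0 shift_1 shift_add)

text \<open>Rational constants contain no variables, so \<open>shift m\<close> is linear over the rationals.\<close>

lemma shift_of_rat: "shift m (of_rat c) = of_rat c"
proof -
  have "shift m (of_int k) = of_int k" for k
    by (cases k rule: int_cases2) (simp_all add: shift_of_nat shift_minus)
  then show ?thesis
    by (cases c) (simp add: of_rat_rat shift_divide)
qed

lemma shift_chi: "shift m (chi N v) = chi N (\<lambda>i. shift m (v i))"
  by (simp add: chi_def shift_1 shift_divide shift_mult shift_diff shift_prod)

text \<open>A collection of functions indexed by the number of variables, such as that of the $\chi_N$, is
  known as a mould; this is its value at a permutation of the variables.\<close>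

definition mould_value :: "gperm \<Rightarrow> ratfun" where
  "mould_value s = chi (gdeg s) (\<lambda>i. xvar (gfun s i))"

lemma chi_cong: "(\<And>i. i \<in> {1..N} \<Longrightarrow> v i = w i) \<Longrightarrow> chi N v = chi N w"
  by (auto simp: chi_eq_gap_recip atLeastLessThanSuc_atLeastAtMost simp del: upt_Suc
      intro!: arg_cong[where f = "\<lambda>u. gap_recip 0 u 1"])

text \<open>Multiplicativity on basis elements.  The chain identity applies to
  $y_i = x_{(\sigma\times\rho)(i)}$: these are distinct variables, its first $m$ values are the
  arguments for $\sigma$, and the others are those for $\rho$ moved past $x_m$.\<close>

lemma sum_mould_value_F_mult:
  "(\<Sum>t\<in>Sh (gdeg s) (gdeg r). mould_value
      (gperm_of (gdeg s + gdeg r) (cross (gdeg s) (gfun s) (gfun r) \<circ> inv t)))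
    = mould_value s * shift (gdeg s) (mould_value r)"
proof -
  define m n p where "m = gdeg s" and "n = gdeg r" and "p = cross m (gfun s) (gfun r)"
  have s: "gfun s permutes {1..m}" and r: "gfun r permutes {1..n}"
    unfolding m_def n_def by (rule gfun_permutes)+
  have p: "p permutes {1..m + n}"
    unfolding p_def using s r by (rule cross_permutes)
  have "mould_value (gperm_of (m + n) (p \<circ> inv t)) = chi (m + n) (\<lambda>i. xvar (p (inv t i)))"
    if "t \<in> Sh m n" for t
  proof -
    have "p \<circ> inv t permutes {1..m + n}"
      using that p by (auto simp: Sh_def intro: permutes_compose permutes_inv)
    then show ?thesis
      by (simp add: mould_value_def gdeg_gperm_of gfun_gperm_of)
  qed
  then have "(\<Sum>t\<in>Sh m n. mould_value (gperm_of (m + n) (p \<circ> inv t)))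
      = (\<Sum>t\<in>Sh m n. chi (m + n) (\<lambda>i. xvar (p (inv t i))))"
    by simp
  also have "\<dots> = chi m (\<lambda>i. xvar (p i)) * chi n (\<lambda>i. xvar (p (m + i)))"
  proof (rule sum_Sh_chi[where y = "\<lambda>i. xvar (p i)"])
    show "inj_on (\<lambda>i. xvar (p i)) {1..m + n}"
      using comp_inj_on[OF permutes_inj_on[OF p] inj_on_subset[OF inj_on_xvar], of "{1..m + n}"] 
        permutes_image[OF p] by (auto simp: o_def)
  qed (use xvar_neq_0_1 in \<open>metis imageE\<close>)+
  also have "chi m (\<lambda>i. xvar (p i)) = mould_value s"
    unfolding mould_value_def m_def[symmetric] by (rule chi_cong) (simp add: p_def cross_def)
  also have "chi n (\<lambda>i. xvar (p (m + i))) = shift m (mould_value r)"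
    unfolding mould_value_def n_def[symmetric] shift_chi
  proof (rule chi_cong)
    fix i assume i: "i \<in> {1..n}"
    then have "1 \<le> gfun r i"
      using permutes_in_image[OF r, of i] by simp
    then show "xvar (p (m + i)) = shift m (xvar (gfun r i))"
      using i by (simp add: shift_xvar p_def cross_def)
  qed
  finally show ?thesis
    by (simp only: m_def n_def p_def)
qed

section \<open>Linear extension\<close>

lemma ssym_expand: "a = (\<Sum>s\<in>Poly_Mapping.keys a. ssym_scale (Poly_Mapping.lookup a s) (basis_F s))"
proof (rule poly_mapping_eqI)
  fix k
  have "(\<Sum>s\<in>Poly_Mapping.keys a. Poly_Mapping.lookup (ssym_scale (Poly_Mapping.lookup a s) (basis_F s)) k)
      = (\<Sum>s\<in>Poly_Mapping.keys a. if s = k then Poly_Mapping.lookup a s else 0)"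
    by (intro sum.cong) (auto simp: lookup_ssym_scale basis_F_def lookup_single when_def)
  then show "Poly_Mapping.lookup a k = Poly_Mapping.lookup (\<Sum>s\<in>Poly_Mapping.keys a. ssym_scale (Poly_Mapping.lookup a s) (basis_F s)) k"
    by (simp add: lookup_sum in_keys_iff)
qed

definition mould_extension :: "ssym \<Rightarrow> ratfun" where
  "mould_extension a = (\<Sum>s\<in>Poly_Mapping.keys a. ratfun_scale (Poly_Mapping.lookup a s) (mould_value s))"

lemma linear_eq_mould_extension:
  assumes "Vector_Spaces.linear ssym_scale ratfun_scale f" and "\<And>s. f (basis_F s) = mould_value s"
  shows "f a = mould_extension a"
proof -
  interpret Vector_Spaces.linear ssym_scale ratfun_scale f by (fact assms(1))
  show ?thesis
    by (subst ssym_expand) (simp add: sum scale assms(2) mould_extension_def)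
qed

lemma linear_mould_extension: "Vector_Spaces.linear ssym_scale ratfun_scale mould_extension"
proof -
  interpret V: vector_space ssym_scale by (rule vector_space_ssym)
  interpret W: vector_space ratfun_scale by (rule vector_space_ratfun)
  have superset: "mould_extension a = (\<Sum>s\<in>S. ratfun_scale (Poly_Mapping.lookup a s) (mould_value s))"
    if "finite S" "Poly_Mapping.keys a \<subseteq> S" for a S
    unfolding mould_extension_def using that
    by (intro sum.mono_neutral_left) (auto simp: in_keys_iff)
  show ?thesis
  proof (unfold_locales)
    fix a b :: ssym
    let ?S = "Poly_Mapping.keys a \<union> Poly_Mapping.keys b"
    show "mould_extension (a + b) = mould_extension a + mould_extension b"
      using Poly_Mapping.keys_add[of a b]
      by (simp add: superset[of ?S] lookup_add W.scale_left_distrib sum.distrib)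
  next
    fix c a
    show "mould_extension (ssym_scale c a) = ratfun_scale c (mould_extension a)"
      by (subst superset[of "Poly_Mapping.keys a"])
        (auto simp: in_keys_iff lookup_ssym_scale mould_extension_def W.scale_sum_right)
  qed
qed

lemma mould_extension_basis: "mould_extension (basis_F s) = mould_value s"
  by (simp add: mould_extension_def basis_F_def ratfun_scale_def)

text \<open>Homogeneity of the left factor makes the shift the same for all basis elements that
  occur in it, so that the shift can be taken out of the double sum.\<close>

lemma mould_extension_mult:
  assumes "a \<in> ssym_homogeneous m"
  shows "mould_extension (a \<star> b) = mould_extension a * shift m (mould_extension b)"
proof -
  interpret Vector_Spaces.linear ssym_scale ratfun_scale mould_extension
    by (rule linear_mould_extension)
  have F: "mould_extension (F_mult s r) = mould_value s * shift m (mould_value r)"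
    if "s \<in> Poly_Mapping.keys a" for s r
  proof -
    have "gdeg s = m"
      using that assms by (simp add: ssym_homogeneous_def)
    then show ?thesis
      using sum_mould_value_F_mult[of s r] by (simp add: F_mult_def sum mould_extension_basis)
  qed
  have "mould_extension (a \<star> b) = (\<Sum>s\<in>Poly_Mapping.keys a. \<Sum>r\<in>Poly_Mapping.keys b.
      ratfun_scale (Poly_Mapping.lookup a s * Poly_Mapping.lookup b r) (mould_value s * shift m (mould_value r)))"
    by (simp add: ssym_mult_def sum scale F)
  also have "\<dots> = mould_extension a * shift m (mould_extension b)"
    by (simp add: mould_extension_def shift_sum sum_product ratfun_scale_def shift_mult
        shift_of_rat of_rat_mult mult_ac)
  finally show ?thesis .
qed

lemma is_character_mould_extension: "is_character mould_extension"
  unfolding is_character_def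
  by (simp add: linear_mould_extension mould_extension_mult ssym_one_def mould_extension_basis
      mould_value_def gdeg_gperm_of permutes_id chi_def)

theorem theorem2p9:
  shows "\<exists>!\<chi> :: ssym \<Rightarrow> ratfun.
    is_character \<chi> \<and>
    (\<forall>\<sigma>. \<chi> (basis_F \<sigma>) = chi (gdeg \<sigma>) (\<lambda>i. xvar (gfun \<sigma> i)))"
proof (intro ex1I[of _ mould_extension] conjI allI)
  show "is_character mould_extension"
    by (rule is_character_mould_extension)
  show "mould_extension (basis_F \<sigma>) = chi (gdeg \<sigma>) (\<lambda>i. xvar (gfun \<sigma> i))" for \<sigma>
    by (simp add: mould_extension_basis mould_value_def)
  fix f :: "ssym \<Rightarrow> ratfun"
  assume "is_character f \<and> (\<forall>\<sigma>. f (basis_F \<sigma>) = chi (gdeg \<sigma>) (\<lambda>i. xvar (gfun \<sigma> i)))"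
  then show "f = mould_extension"
    by (intro ext linear_eq_mould_extension) (simp_all add: is_character_def mould_value_def)
qed

end
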